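(* For any odd prime power $q$, there exist the following pencil arcs in $\Pi_2(q^2)$: (i) a $(q^2+q)$-parc $\mathcal{K}$ in which there are two lines of the pencil containing $q$ points of $\mathcal{K}$ and $(q-1)/2$ lines of the pencil containing $2q$ points of $\mathcal{K}$; (ii) a regular $((q+1)/2,\,2q)$-parc; (iii) a regular $(q,q)$-parc.
   Context: $\Pi_2(n)$ denotes the desarguesian projective plane over $GF(n)$. A pencil in $\Pi_2(n)$ is the set of all $n+1$ lines $\Psi_0,\ldots,\Psi_n$ through some common point. A $k$-parc (pencil arc) in $\Pi_2(n)$ with pencil $\Psi_0,\ldots,\Psi_n$ is a set $\mathcal{K}$ of $k$ points such that: (a) each $\mathcal{K}\cap\Psi_i$ is an $h_i$-arc in the projective line $\Psi_i$, where $h_i=|\mathcal{K}\cap\Psi_i|$ (i.e. any two of its points are independent, which is automatic); (b) $\mathcal{K}\cap\Psi_i\cap\Psi_j=\emptyset$ for $i\neq j$; (c) any three points of $\mathcal{K}$ not contained in any single $\Psi_i$ are linearly independent (non-collinear). A regular $(m,h)$-parc is a pencil arc for which, for a suitable labelling of the lines of the pencil, $h_0=h_1=\cdots=h_{m-1}=h$ and $h_m=\cdots=h_n=0$. *)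

theory Defs
  imports "HOL-Analysis.Analysis" "HOL-Number_Theory.Prime_Powers"
begin

text \<open>The desarguesian plane over a finite field \<open>'a\<close>: points are the one-dimensional
  subspaces of \<open>'a ^ 3\<close>, and a line is the set of points contained in a two-dimensional
  subspace. Linear-algebraic notions carry the prefix \<open>vec\<close>: they are taken over
  \<open>'a\<close>, not over the reals.\<close>

type_synonym 'a pg_point = "('a ^ 3) set"

definition pg_points :: "'a::field pg_point set" where
  "pg_points = {P. vec.subspace P \<and> vec.dim P = 1}"

definition pg_lines :: "'a::field pg_point set set" where
  "pg_lines = {{P \<in> pg_points. P \<subseteq> W} | W. vec.subspace W \<and> vec.dim W = 2}"

text \<open>Points are independent if nonzero vectors representing them are. Distinct points have
  distinct representatives, so passing to the image \<open>v ` S\<close> loses no repetitions.\<close>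

definition pg_independent :: "'a::field pg_point set \<Rightarrow> bool" where
  "pg_independent S \<longleftrightarrow>
     (\<forall>v. (\<forall>P\<in>S. v P \<in> P \<and> v P \<noteq> 0) \<longrightarrow> vec.independent (v ` S))"

definition line_arc :: "nat \<Rightarrow> 'a::field pg_point set \<Rightarrow> 'a pg_point set \<Rightarrow> bool" where
  "line_arc h L A \<longleftrightarrow>
     A \<subseteq> L \<and> finite A \<and> card A = h \<and>
     (\<forall>P\<in>A. \<forall>Q\<in>A. P \<noteq> Q \<longrightarrow> pg_independent {P, Q})"

text \<open>A labelled pencil \<open>\<Psi> 0, \<dots>, \<Psi> n\<close>, where \<open>n\<close> is the order of the plane;
  values of \<open>\<Psi>\<close> beyond \<open>n\<close> are irrelevant.\<close>

definition is_pencil :: "(nat \<Rightarrow> 'a::{field,finite} pg_point set) \<Rightarrow> bool" where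
  "is_pencil \<Psi> \<longleftrightarrow>
     (\<exists>X\<in>pg_points. bij_betw \<Psi> {..CARD('a)} {L \<in> pg_lines. X \<in> L})"

definition is_parc ::
  "nat \<Rightarrow> 'a::{field,finite} pg_point set \<Rightarrow> (nat \<Rightarrow> 'a pg_point set) \<Rightarrow> bool" where
  "is_parc k K \<Psi> \<longleftrightarrow>
     K \<subseteq> pg_points \<and> finite K \<and> card K = k \<and> is_pencil \<Psi> \<and>
     (\<forall>i\<le>CARD('a). line_arc (card (K \<inter> \<Psi> i)) (\<Psi> i) (K \<inter> \<Psi> i)) \<and>
     (\<forall>i\<le>CARD('a). \<forall>j\<le>CARD('a). i \<noteq> j \<longrightarrow> K \<inter> \<Psi> i \<inter> \<Psi> j = {}) \<and>
     (\<forall>P\<in>K. \<forall>Q\<in>K. \<forall>R\<in>K. P \<noteq> Q \<and> P \<noteq> R \<and> Q \<noteq> R \<and>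
        \<not> (\<exists>i\<le>CARD('a). {P, Q, R} \<subseteq> \<Psi> i) \<longrightarrow> pg_independent {P, Q, R})"

definition is_regular_parc :: "nat \<Rightarrow> nat \<Rightarrow> 'a::{field,finite} pg_point set \<Rightarrow> bool" where
  "is_regular_parc m h K \<longleftrightarrow>
     m \<le> CARD('a) + 1 \<and>
     (\<exists>\<Psi>. is_parc (card K) K \<Psi> \<and>
        (\<forall>i<m. card (K \<inter> \<Psi> i) = h) \<and>
        (\<forall>i\<in>{m..CARD('a)}. card (K \<inter> \<Psi> i) = 0))"

end

theory Submission
  imports Defs "HOL-Computational_Algebra.Polynomial" "HOL-Number_Theory.Residues"
begin

text \<open>Let \<open>B\<close> be the subfield of order \<open>q\<close> of the field \<open>F\<close> of order \<open>q\<^sup>2\<close>, and let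
  \<open>e \<in> F - B\<close>. Take an arc in the subplane over \<open>B\<close>, with representatives \<open>c i\<close> over \<open>B\<close>, and
  a vector \<open>V\<close> over \<open>B\<close> that represents a point off the arc. The set \<open>K\<close> of the points spanned by
  the vectors \<open>c i + t e V\<close>, for \<open>t \<in> B\<close>, is a pencil arc with vertex \<open>V\<close>. Indeed, by
  multilinearity the determinant of three such vectors is \<open>det (c i, c j, c k) + e b\<close> with
  \<open>b \<in> B\<close>, because terms in which \<open>V\<close> is repeated vanish. As \<open>1, e\<close> are independent over \<open>B\<close>, the
  determinant is nonzero when \<open>i, j, k\<close> are distinct (\<open>det3_rep_nonzero\<close>). If two of the points
  come from the same arc point, they span a line of the pencil, and the third point is not on it
  by hypothesis.

  A line of the pencil contains \<open>q\<close> points of \<open>K\<close> for each arc point on it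
  (\<open>card_parc_Int_line\<close>). So tangents of the arc through \<open>V\<close> contain \<open>q\<close> points, and secants
  contain \<open>2 q\<close>. It remains to take the \<open>q + 1\<close> points of the conic \<open>y\<^sup>2 = x z\<close> over \<open>B\<close> and
  to choose \<open>V\<close>. An external point is on two tangents and \<open>(q - 1) / 2\<close> secants; an internal
  point is on no tangent and \<open>(q + 1) / 2\<close> secants. When \<open>V\<close> is a point of the conic, it is removed
  from the arc, and each of the \<open>q\<close> remaining points is alone on its line through \<open>V\<close>. These
  numbers are read off from the fixed points of the involution that \<open>V\<close> induces on the conic, the
  identity in the last case (\<open>card_parc_lines\<close>).\<close>

section \<open>The subfield of order \<open>q\<close>\<close>

text \<open>A subfield as a subset of the ambient field. Since \<open>inverse 0 = 0\<close>, closure under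
  inverses needs no side condition.\<close>

locale closed_subfield =
  fixes B :: "'a::field set"
  assumes one_mem: "1 \<in> B"
    and diff_mem: "\<And>x y. x \<in> B \<Longrightarrow> y \<in> B \<Longrightarrow> x - y \<in> B"
    and mult_mem: "\<And>x y. x \<in> B \<Longrightarrow> y \<in> B \<Longrightarrow> x * y \<in> B"
    and inverse_mem: "\<And>x. x \<in> B \<Longrightarrow> inverse x \<in> B"
begin

lemma zero_mem: "0 \<in> B"
  using diff_mem[OF one_mem one_mem] by simp

lemma uminus_mem: "x \<in> B \<Longrightarrow> - x \<in> B"
  using diff_mem[OF zero_mem] by simp

lemma add_mem: "x \<in> B \<Longrightarrow> y \<in> B \<Longrightarrow> x + y \<in> B"
  using diff_mem[of x "- y"] uminus_mem by simp

lemma divide_mem: "x \<in> B \<Longrightarrow> y \<in> B \<Longrightarrow> x / y \<in> B"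
  by (simp add: divide_inverse mult_mem inverse_mem)

lemmas mems = zero_mem one_mem diff_mem mult_mem inverse_mem uminus_mem add_mem divide_mem

text \<open>The elements \<open>1\<close> and \<open>e\<close> are linearly independent over the subfield.\<close>

lemma zero_if_scaled_mem:
  assumes "e \<notin> B" "x \<in> B" "y \<in> B" "x + e * y = 0"
  shows "x = 0" "y = 0"
proof -
  show y: "y = 0"
  proof (rule ccontr)
    assume "y \<noteq> 0"
    then have "e = - x / y"
      using assms(4) by (simp add: field_simps eq_neg_iff_add_eq_0)
    then show False
      using assms(1-3) by (simp add: mems)
  qed
  show "x = 0"
    using assms(4) y by simp
qed

end

lemma power_card_field:
  fixes x :: "'a::{field,finite}"
  shows "x ^ CARD('a) = x"
proof (cases "x = 0")
  case False
  let ?U = "UNIV - {0 :: 'a}"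
  have "bij_betw ((*) x) ?U ?U"
    by (rule bij_betw_byWitness[where f' = "\<lambda>y. y / x"]) (use False in auto)
  then have "\<Prod>?U = (\<Prod>y\<in>?U. x * y)"
    using prod.reindex_bij_betw[of "(*) x" ?U ?U "\<lambda>y. y"] by simp
  also have "\<dots> = x ^ card ?U * \<Prod>?U"
    by (simp add: prod.distrib)
  finally have "x ^ card ?U * \<Prod>?U = 1 * \<Prod>?U"
    by (simp only: mult_1_left)
  moreover have "\<Prod>?U \<noteq> 0"
    by (subst prod_zero_iff) auto
  ultimately have "x ^ card ?U = 1"
    by (metis mult_right_cancel)
  moreover have "CARD('a) = Suc (card ?U)"
    by (rule card.remove) auto
  ultimately show ?thesis
    by (metis mult_1_right power_Suc)
qed (simp add: zero_power)

lemma card_kernel_times_range: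
  fixes f :: "'a::{ab_group_add,finite} \<Rightarrow> 'b::ab_group_add"
  assumes "\<And>x y. f (x - y) = f x - f y"
  shows "card {x. f x = 0} * card (range f) = CARD('a)"
proof -
  have fib: "card {x. f x = y} = card {x. f x = 0}" if y: "y \<in> range f" for y
  proof -
    obtain a where a: "y = f a"
      using y by blast
    have add: "f (x + y) = f x + f y" for x y
      using assms[of "x + y" y] by simp
    have "bij_betw (\<lambda>x. x + a) {x. f x = 0} {x. f x = y}"
      by (rule bij_betw_byWitness[where f' = "\<lambda>x. x - a"]) (auto simp: a assms add)
    then show ?thesis
      by (simp add: bij_betw_same_card)
  qed
  have "CARD('a) = (\<Sum>y\<in>range f. card {x \<in> UNIV. f x = y})"
    unfolding card_eq_sum by (rule sum.image_gen) simp
  also have "\<dots> = card {x. f x = 0} * card (range f)"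
    using fib by (simp add: mult.commute)
  finally show ?thesis ..
qed

lemma char_eq_prime_base:
  assumes "CARD('a::{field,finite}) = p ^ k" "prime p"
  shows "CHAR('a) = p"
proof -
  have "prime CHAR('a)"
    by (rule prime_CHAR_semidom) (rule finite_imp_CHAR_pos, simp)
  moreover have "CHAR('a) dvd p ^ k"
    using CHAR_dvd_CARD[where 'a = 'a] assms(1) by simp
  ultimately show ?thesis
    using assms(2) by (metis prime_dvd_power primes_dvd_imp_eq)
qed

lemma card_power_eq_scaled_le:
  fixes a :: "'a::field"
  assumes "q > 1"
  shows "card {x :: 'a. x ^ q = a * x} \<le> q"
proof -
  let ?p = "Polynomial.monom 1 q - Polynomial.monom a 1"
  have "Polynomial.coeff ?p q = 1"
    using assms by simp
  then have "?p \<noteq> 0"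
    by (metis Polynomial.coeff_0 zero_neq_one)
  moreover have "Polynomial.degree ?p \<le> q"
    using assms by (intro degree_diff_le) (auto intro: order_trans[OF Polynomial.degree_monom_le])
  ultimately have "card {x. poly ?p x = 0} \<le> q"
    using card_poly_roots_bound order_trans by blast
  then show ?thesis
    by (simp add: poly_monom)
qed

text \<open>The subfield consists of the fixed points of \<open>x \<mapsto> x\<^sup>q\<close>, the kernel of the additive
  map \<open>x \<mapsto> x\<^sup>q - x\<close>. Every value \<open>y\<close> of this map satisfies \<open>y\<^sup>q = - y\<close>, so kernel and range
  both have at most \<open>q\<close> elements, while the product of their sizes is \<open>q\<^sup>2\<close>.\<close>

lemma exists_closed_subfield:
  assumes "primepow q" and card: "CARD('a::{field,finite}) = q ^ 2"
  shows "\<exists>B :: 'a set. closed_subfield B \<and> card B = q"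
proof -
  obtain p k where p: "prime p" "k > 0" "q = p ^ k"
    using assms(1) by (auto simp: primepow_def)
  have q1: "q > 1"
    using assms(1) by (rule primepow_gt_Suc_0[unfolded One_nat_def[symmetric]])
  have char: "CHAR('a) = p"
    using card p by (intro char_eq_prime_base[of p "k * 2"]) (simp_all add: power_mult)
  have add: "(x + y) ^ q = x ^ q + y ^ q" for x y :: 'a
    by (rule freshmans_dream'[of _ k]) (use char p in auto)
  have diff: "(x - y) ^ q = x ^ q - y ^ q" for x y :: 'a
    using add[of "x - y" y] by (simp add: algebra_simps)
  define B where "B = {x :: 'a. x ^ q = x}"
  have sub: "closed_subfield B"
    by unfold_locales (auto simp: B_def diff power_mult_distrib power_inverse)
  have "range (\<lambda>x :: 'a. x ^ q - x) \<subseteq> {x. x ^ q = - 1 * x}"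
  proof safe
    fix x :: 'a
    have "(x ^ q) ^ q = x"
      using power_card_field[of x] card by (simp add: power2_eq_square power_mult)
    then show "(x ^ q - x) ^ q = - 1 * (x ^ q - x)"
      by (simp add: diff)
  qed
  then have "card (range (\<lambda>x :: 'a. x ^ q - x)) \<le> q"
    using card_power_eq_scaled_le[OF q1, of "- 1 :: 'a"]
    by (meson card_mono finite order_trans)
  moreover have ker: "card B * card (range (\<lambda>x :: 'a. x ^ q - x)) = CARD('a)"
    using card_kernel_times_range[of "\<lambda>x :: 'a. x ^ q - x"] by (simp add: diff B_def)
  ultimately have "q * q \<le> card B * q"
    by (metis (no_types, lifting) card mult_le_mono2 ker power2_eq_square)
  then have "q \<le> card B"
    using q1 by simp
  moreover have "card B \<le> q"
    using card_power_eq_scaled_le[OF q1, of "1 :: 'a"] by (simp add: B_def)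
  ultimately show ?thesis
    using sub by auto
qed

lemma (in closed_subfield) exists_nonsquare:
  assumes "finite B" "(1 :: 'a) \<noteq> - 1"
  shows "\<exists>n\<in>B. \<forall>s\<in>B. s * s \<noteq> n"
proof (rule ccontr)
  assume "\<not> ?thesis"
  then have "B \<subseteq> (\<lambda>s. s * s) ` B"
    by force
  then have "inj_on (\<lambda>s. s * s) B"
    by (rule finite_surj_inj[OF assms(1)])
  then have "(1 :: 'a) = - 1"
    by (rule inj_onD) (auto simp: mems)
  then show False
    using assms(2) by simp
qed

lemma one_neq_minus_one:
  assumes "odd CARD('a::{field,finite})"
  shows "(1 :: 'a) \<noteq> - 1"
proof
  assume eq: "(1 :: 'a) = - 1"
  have "of_nat CARD('a) = (0 :: 'a)"
    by (simp only: of_nat_eq_0_iff_char_dvd CHAR_dvd_CARD)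
  moreover have "(2 :: 'a) = 0"
    using eq by (metis add.right_inverse one_add_one)
  moreover obtain k where "CARD('a) = 2 * k + 1"
    using assms by (elim oddE)
  ultimately show False
    by simp
qed

section \<open>Points, lines and pencils in coordinates\<close>

text \<open>The projective point with representative \<open>v \<noteq> 0\<close>.\<close>

abbreviation point :: "'a::field ^ 3 \<Rightarrow> 'a pg_point" where
  "point v \<equiv> vec.span {v}"

text \<open>The join of the points spanned by \<open>V\<close> and \<open>u\<close>; a line if \<open>u\<close> is not a
  multiple of \<open>V \<noteq> 0\<close>.\<close>

definition line_join :: "'a::field ^ 3 \<Rightarrow> 'a ^ 3 \<Rightarrow> 'a pg_point set" where
  "line_join V u = {P \<in> pg_points. P \<subseteq> vec.span {V, u}}"

lemma in_point_iff: "x \<in> point v \<longleftrightarrow> (\<exists>a. x = a *s v)"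
  by (auto simp: vec.span_singleton)

lemma in_span2_iff: "x \<in> vec.span {V, u} \<longleftrightarrow> (\<exists>a b. x = a *s V + b *s (u :: 'a::field ^ 3))"
proof -
  have "x \<in> vec.span {V, u} \<longleftrightarrow> (\<exists>a. x - a *s V \<in> vec.span {u})"
    by (rule vec.span_breakdown_eq)
  also have "\<dots> \<longleftrightarrow> (\<exists>a b. x = a *s V + b *s u)"
    by (simp add: vec.span_singleton image_iff algebra_simps)
  finally show ?thesis .
qed

lemma point_in_pg_points: "v \<noteq> 0 \<Longrightarrow> point v \<in> pg_points"
  by (simp add: pg_points_def)

lemma point_eq_if_mem:
  assumes "P \<in> pg_points" "v \<in> P" "v \<noteq> 0"
  shows "P = point v"
proof -
  have "point v \<subseteq> P"
    using assms by (intro vec.span_minimal) (auto simp: pg_points_def)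
  then show ?thesis
    using assms vec.subspace_dim_equal[of "point v" P] by (simp add: pg_points_def)
qed

lemma point_subset_iff: "vec.subspace W \<Longrightarrow> point v \<subseteq> W \<longleftrightarrow> v \<in> W"
  by (meson insert_subset empty_subsetI vec.span_minimal vec.span_superset order_trans)

lemma point_in_line_join_iff:
  "v \<noteq> 0 \<Longrightarrow> point v \<in> line_join V u \<longleftrightarrow> v \<in> vec.span {V, u}"
  by (simp add: line_join_def point_in_pg_points point_subset_iff)

lemma pg_independent_pair:
  assumes "P \<in> pg_points" "Q \<in> pg_points" "P \<noteq> Q"
  shows "pg_independent {P, Q}"
  unfolding pg_independent_def
proof (intro allI impI)
  fix v assume v: "\<forall>R\<in>{P, Q}. v R \<in> R \<and> v R \<noteq> 0"
  then have "v P \<notin> point (v Q)"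
    using assms point_eq_if_mem[of P "v P"] point_eq_if_mem[of Q "v Q"] point_eq_if_mem[of Q "v P"]
    by auto
  then have "vec.independent {v P, v Q}"
    using v by (simp add: vec.independent_insert)
  then show "vec.independent (v ` {P, Q})"
    by simp
qed

text \<open>The subspace \<open>W\<close> may have any dimension; it serves both as the two-dimensional space of a line
  through \<open>P\<close> and \<open>Q\<close> and as the kernel of a determinant.\<close>

lemma pg_independent_triple:
  assumes "P \<in> pg_points" "Q \<in> pg_points" "R \<in> pg_points" "P \<noteq> Q"
    and W: "vec.subspace W" "P \<subseteq> W" "Q \<subseteq> W" "\<not> R \<subseteq> W"
  shows "pg_independent {P, Q, R}"
  unfolding pg_independent_def
proof (intro allI impI)
  fix v assume v: "\<forall>S\<in>{P, Q, R}. v S \<in> S \<and> v S \<noteq> 0"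
  have "vec.independent (v ` {P, Q})"
    using pg_independent_pair[OF assms(1,2,4)] v unfolding pg_independent_def by simp
  moreover have "v R \<notin> W"
    using v assms(3) W point_eq_if_mem[of R "v R"] point_subset_iff[of W "v R"] by auto
  moreover have "vec.span (v ` {P, Q}) \<subseteq> W"
    using v W by (intro vec.span_minimal) auto
  ultimately have "vec.independent (insert (v R) (v ` {P, Q}))"
    by (intro vec.independent_insertI) auto
  then show "vec.independent (v ` {P, Q, R})"
    by (simp add: insert_commute)
qed

lemma dim_span2:
  "V \<noteq> 0 \<Longrightarrow> u \<notin> point V \<Longrightarrow> vec.dim (vec.span {V, u :: 'a::field ^ 3}) = 2"
  by (simp add: vec.dim_insert insert_commute[of V u])

lemma span2_exchange:
  assumes "w \<in> vec.span {V, u}" "w \<notin> point V"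
  shows "vec.span {V, w} = vec.span {V, u :: 'a::field ^ 3}"
proof -
  have "u \<in> vec.span {V, w}"
    using vec.in_span_insert[of w u "{V}"] assms by (simp add: insert_commute)
  then show ?thesis
    using assms(1) by (intro equalityI vec.span_minimal) (auto intro: vec.span_base)
qed

lemma line_join_eq_iff:
  assumes "u \<notin> point V" "w \<notin> point V"
  shows "line_join V u = line_join V w \<longleftrightarrow> w \<in> vec.span {V, u}"
proof
  have w: "w \<noteq> 0"
    using assms(2) vec.span_zero by auto
  assume eq: "line_join V u = line_join V w"
  have "point w \<in> line_join V w"
    by (simp add: point_in_line_join_iff w vec.span_base)
  then show "w \<in> vec.span {V, u}"
    by (simp add: point_in_line_join_iff w flip: eq)
next
  assume "w \<in> vec.span {V, u}"
  then show "line_join V u = line_join V w"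
    using span2_exchange[of w V u] assms(2) by (simp add: line_join_def)
qed

text \<open>The set of all lines through \<open>X\<close>, without a labelling.\<close>

definition pencil :: "'a::field pg_point \<Rightarrow> 'a pg_point set set" where
  "pencil X = {L \<in> pg_lines. X \<in> L}"

lemma line_join_in_pencil:
  assumes "V \<noteq> 0" "u \<notin> point V"
  shows "line_join V u \<in> pencil (point V)"
proof -
  have "point V \<in> line_join V u"
    using assms(1) by (simp add: point_in_line_join_iff vec.span_base)
  moreover have "line_join V u \<in> pg_lines"
    using dim_span2[OF assms] by (auto simp: pg_lines_def line_join_def simp del: vec.dim_span)
  ultimately show ?thesis
    by (simp add: pencil_def)
qed

lemma pencilE:
  assumes "L \<in> pencil (point V)" "V \<noteq> 0"
  obtains u where "u \<notin> point V" "L = line_join V u"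
proof -
  obtain W where W: "vec.subspace W" "vec.dim W = 2" "L = {P \<in> pg_points. P \<subseteq> W}" "V \<in> W"
    using assms by (auto simp: pencil_def pg_lines_def point_subset_iff)
  have "\<not> W \<subseteq> point V"
    using vec.dim_subset[of W "point V"] W(2) by (auto split: if_splits)
  then obtain u where u: "u \<in> W" "u \<notin> point V"
    by auto
  have "vec.span {V, u} \<subseteq> W"
    using W u by (intro vec.span_minimal) auto
  then have "vec.span {V, u} = W"
    using W dim_span2[OF assms(2) u(2)] by (intro vec.subspace_dim_equal) auto
  then show ?thesis
    using that[OF u(2)] W(3) by (simp add: line_join_def)
qed

lemma finite_pencil: "finite (pencil (X :: 'a::{field,finite} pg_point))"
  by simp

text \<open>If \<open>V, a, b\<close> is a basis, then the lines through \<open>V\<close> are the joins of \<open>V\<close> with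
  \<open>a\<close> and with the points \<open>b + k a\<close>.\<close>

lemma card_pencil:
  fixes V :: "'a::{field,finite} ^ 3"
  assumes V: "V \<noteq> 0"
  shows "card (pencil (point V)) = CARD('a) + 1"
proof -
  have U: "vec.dim (UNIV :: ('a ^ 3) set) = 3"
    by (subst vec_dim_card) simp
  have "point V \<noteq> UNIV"
  proof
    assume "point V = UNIV"
    then have "vec.dim {V} = 3"
      using U vec.dim_span[of "{V}"] by metis
    then show False
      by (simp split: if_splits)
  qed
  then obtain a where a: "a \<notin> point V"
    by auto
  have "vec.span {V, a} \<noteq> UNIV"
    using U dim_span2[OF V a] by fastforce
  then obtain b where b: "b \<notin> vec.span {V, a}"
    by auto
  have "vec.dim (vec.span {b, V, a}) = 3"
    using b dim_span2[OF V a] by (simp add: vec.dim_insert)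
  then have full: "vec.span {b, V, a} = UNIV"
    using U vec.subspace_dim_equal[of "vec.span {b, V, a}" UNIV] by simp
  have b_coeff: "k = 0" if "k *s b \<in> vec.span {V, a}" for k
    using b that vec.span_scale[of "k *s b" "{V, a}" "inverse k"] by (cases "k = 0") auto
  define f where "f = case_option a (\<lambda>k. b + k *s a)"
  have sub: "point V \<subseteq> vec.span {V, a}"
    by (intro vec.span_mono) auto
  have a_mem: "k *s a \<in> vec.span {V, a}" and V_mem: "k *s V \<in> vec.span {V, a}" for k
    by (auto intro: vec.span_scale vec.span_base)
  have f_notin: "f x \<notin> point V" for x
  proof (cases x)
    case (Some k)
    have "b + k *s a \<notin> vec.span {V, a}"
      using b vec.span_diff[OF _ a_mem, of "b + k *s a" k] by auto
    then show ?thesis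
      using Some sub by (auto simp: f_def)
  qed (simp add: f_def a)
  have "inj (\<lambda>x. line_join V (f x))"
  proof (rule injI)
    fix x y assume "line_join V (f x) = line_join V (f y)"
    then have "f y \<in> vec.span {V, f x}" "f x \<in> vec.span {V, f y}"
      using line_join_eq_iff[OF f_notin f_notin] by metis+
    then show "x = y"
    proof (cases x; cases y)
      fix k assume "x = None" "y = Some k"
      then have "b + k *s a \<in> vec.span {V, a}"
        using \<open>f y \<in> vec.span {V, f x}\<close> by (simp add: f_def)
      then show "x = y"
        using b vec.span_diff[OF _ a_mem, of "b + k *s a" k] by auto
    next
      fix k assume "y = None" "x = Some k"
      then have "b + k *s a \<in> vec.span {V, a}"
        using \<open>f x \<in> vec.span {V, f y}\<close> by (simp add: f_def)
      then show "x = y"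
        using b vec.span_diff[OF _ a_mem, of "b + k *s a" k] by auto
    next
      fix k l assume xy: "x = Some k" "y = Some l"
      then obtain r s where rs: "b + l *s a = r *s V + s *s (b + k *s a)"
        using \<open>f y \<in> vec.span {V, f x}\<close> by (auto simp: f_def in_span2_iff)
      then have "(1 - s) *s b = r *s V + (s * k - l) *s a"
        by (simp add: vec_eq_iff algebra_simps)
      then have "(1 - s) *s b \<in> vec.span {V, a}"
        by (simp only: vec.span_add[OF V_mem a_mem])
      then have "s = 1"
        using b_coeff by fastforce
      with rs have eq: "(l - k) *s a = r *s V"
        by (simp add: vec_eq_iff algebra_simps)
      have "l = k"
      proof (rule ccontr)
        assume "l \<noteq> k"
        then have "a = (r / (l - k)) *s V"
          using eq by (auto simp: vec_eq_iff field_simps)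
        then show False
          using a in_point_iff by blast
      qed
      then show "x = y"
        by (simp add: xy)
    qed simp
  qed
  moreover have "range (\<lambda>x. line_join V (f x)) = pencil (point V)"
  proof (intro equalityI subsetI)
    fix L assume "L \<in> pencil (point V)"
    then obtain u where u: "u \<notin> point V" "L = line_join V u"
      using V by (rule pencilE)
    obtain k where "u - k *s b \<in> vec.span {V, a}"
      using full vec.span_breakdown_eq[of u b "{V, a}"] by auto
    then obtain r s where "u - k *s b = r *s V + s *s a"
      by (auto simp: in_span2_iff)
    then have k: "u = k *s b + r *s V + s *s a"
      by (simp add: algebra_simps)
    have "\<exists>x. f x \<in> vec.span {V, u}"
    proof (cases "k = 0")
      case True
      then have "s \<noteq> 0"
        using u(1) k by (auto simp: in_point_iff)
      then have "f None = (- r / s) *s V + (1 / s) *s u"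
        using True by (simp add: k f_def vec_eq_iff field_simps)
      then show ?thesis
        using in_span2_iff by blast
    next
      case False
      then have "f (Some (s / k)) = (- r / k) *s V + (1 / k) *s u"
        by (simp add: k f_def vec_eq_iff field_simps)
      then show ?thesis
        using in_span2_iff by blast
    qed
    then show "L \<in> range (\<lambda>x. line_join V (f x))"
      using line_join_eq_iff[OF u(1) f_notin] u(2) by auto
  qed (use line_join_in_pencil[OF V f_notin] in blast)
  ultimately have "card (pencil (point V)) = CARD('a option)"
    by (metis card_image)
  then show ?thesis
    by simp
qed

lemma is_pencil_iff:
  "is_pencil \<Psi> \<longleftrightarrow> (\<exists>X\<in>pg_points. bij_betw \<Psi> {..CARD('a)} (pencil X))"
  for \<Psi> :: "nat \<Rightarrow> 'a::{field,finite} pg_point set"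
  by (simp add: is_pencil_def pencil_def)

text \<open>The lines of a pencil can be labelled so that a given set of them comes first.\<close>

lemma exists_pencil_labelling:
  fixes V :: "'a::{field,finite} ^ 3"
  assumes V: "V \<noteq> 0" and A: "A \<subseteq> pencil (point V)"
  shows "card A \<le> CARD('a) + 1 \<and> (\<exists>\<Psi>. bij_betw \<Psi> {..CARD('a)} (pencil (point V)) \<and>
    (\<forall>i<card A. \<Psi> i \<in> A) \<and> (\<forall>i\<in>{card A..CARD('a)}. \<Psi> i \<notin> A))"
proof -
  let ?L = "pencil (point V)"
  have le: "card A \<le> CARD('a) + 1"
    using card_mono[OF finite_pencil A] card_pencil[OF V] by simp
  obtain f where f: "bij_betw f {..<card A} A"
    using ex_bij_betw_nat_finite[of A] finite_subset[OF A finite_pencil] by (auto simp: atLeast0LessThan)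
  have "card {card A..CARD('a)} = card (?L - A)"
    using card_pencil[OF V] A by (simp add: card_Diff_subset)
  then obtain g where g: "bij_betw g {card A..CARD('a)} (?L - A)"
    using finite_same_card_bij[of "{card A..CARD('a)}" "?L - A"] by auto
  define h where "h = (\<lambda>i. if i \<in> {..<card A} then f i else g i)"
  have "bij_betw h ({..<card A} \<union> {card A..CARD('a)}) (A \<union> (?L - A))"
    unfolding h_def by (rule bij_betw_disjoint_Un[OF f g]) auto
  moreover have "{..<card A} \<union> {card A..CARD('a)} = {..CARD('a)}"
    using le by auto
  moreover have "A \<union> (?L - A) = ?L"
    using A by auto
  moreover have "\<forall>i<card A. h i \<in> A" "\<forall>i\<in>{card A..CARD('a)}. h i \<notin> A"
    using bij_betwE[OF f] bij_betwE[OF g] by (auto simp: h_def)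
  ultimately show ?thesis
    using le by auto
qed

section \<open>Translates of an arc towards the vertex of a pencil\<close>

text \<open>The determinant of the matrix with rows \<open>u\<close>, \<open>v\<close>, \<open>w\<close>.\<close>

definition det3 :: "'a::comm_ring_1 ^ 3 \<Rightarrow> 'a ^ 3 \<Rightarrow> 'a ^ 3 \<Rightarrow> 'a" where
  "det3 u v w = u$1 * (v$2 * w$3 - v$3 * w$2) - u$2 * (v$1 * w$3 - v$3 * w$1)
     + u$3 * (v$1 * w$2 - v$2 * w$1)"

lemma det3_translate:
  "det3 (u + (r * e) *s V) (v + (s * e) *s V) (w + (t * e) *s V) =
     det3 u v w + e * (r * det3 V v w + s * det3 u V w + t * det3 u v V)"
  by (simp add: det3_def algebra_simps)

lemma det3_repeat: "det3 u v (k *s u) = 0" "det3 u v (k *s v) = 0" "det3 u v v = 0"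
  by (simp_all add: det3_def algebra_simps)

lemma subspace_det3_eq_0: "vec.subspace {w. det3 u v w = (0 :: 'a::field)}"
proof (rule vec.subspaceI)
  show "k *s w \<in> {w. det3 u v w = 0}" if "w \<in> {w. det3 u v w = 0}" for k w
  proof -
    have "det3 u v (k *s w) = k * det3 u v w"
      by (simp add: det3_def algebra_simps)
    then show ?thesis
      using that by simp
  qed
  show "x + y \<in> {w. det3 u v w = 0}" if "x \<in> {w. det3 u v w = 0}" "y \<in> {w. det3 u v w = 0}" for x y
  proof -
    have "det3 u v (x + y) = det3 u v x + det3 u v y"
      by (simp add: det3_def algebra_simps)
    then show ?thesis
      using that by simp
  qed
qed (simp add: det3_def)

text \<open>The vectors \<open>c i\<close>, with entries in the subfield \<open>B\<close>, represent an arc of the subplane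
  over \<open>B\<close>. The point spanned by \<open>V\<close> is rational over \<open>B\<close> too, and it is not on the arc. The
  element \<open>e\<close> is any field element outside \<open>B\<close>.\<close>

locale translated_arc = closed_subfield B for B :: "'a::{field,finite} set" +
  fixes e :: 'a and V :: "'a ^ 3" and c :: "'i \<Rightarrow> 'a ^ 3" and I :: "'i set"
  assumes e_notin: "e \<notin> B"
    and V_mem: "\<And>j. V $ j \<in> B"
    and V_nonzero: "V \<noteq> 0"
    and c_mem: "\<And>i j. i \<in> I \<Longrightarrow> c i $ j \<in> B"
    and c_notin: "\<And>i. i \<in> I \<Longrightarrow> c i \<notin> point V"
    and arc: "\<And>i j k. \<lbrakk>i \<in> I; j \<in> I; k \<in> I; i \<noteq> j; i \<noteq> k; j \<noteq> k\<rbrakk> \<Longrightarrow> det3 (c i) (c j) (c k) \<noteq> 0"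
    and card_ge_3: "card I \<ge> 3"
begin

text \<open>Each arc point is replaced by its \<open>card B\<close> translates by \<open>B\<close>-multiples of \<open>e V\<close>,
  all of which lie on the line joining it to \<open>V\<close>.\<close>

definition rep :: "'i \<Rightarrow> 'a \<Rightarrow> 'a ^ 3" where
  "rep i t = c i + (t * e) *s V"

text \<open>The set of all translates; it is a pencil arc with vertex \<open>V\<close>.\<close>

definition parc :: "'a pg_point set" where
  "parc = (\<lambda>(i, t). point (rep i t)) ` (I \<times> B)"

lemma finite_I: "finite I"
  using card_ge_3 card_gt_0_iff[of I] by simp

lemma parcE:
  assumes "P \<in> parc"
  obtains i t where "i \<in> I" "t \<in> B" "P = point (rep i t)"
  using assms by (auto simp: parc_def)

lemma rep_in_span_iff: "rep i t \<in> vec.span (insert V S) \<longleftrightarrow> c i \<in> vec.span (insert V S)"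
proof -
  have "(t * e) *s V \<in> vec.span (insert V S)"
    by (auto intro: vec.span_scale vec.span_base)
  then show ?thesis
    using vec.span_add_eq2 by (auto simp: rep_def)
qed

lemma rep_notin: "i \<in> I \<Longrightarrow> rep i t \<notin> point V"
  using rep_in_span_iff[of i t "{}"] c_notin by simp

lemma rep_nonzero: "i \<in> I \<Longrightarrow> rep i t \<noteq> 0"
  using rep_notin[of i t] vec.span_zero by metis

lemma det3_mem:
  "\<lbrakk>\<And>j. u $ j \<in> B; \<And>j. v $ j \<in> B; \<And>j. w $ j \<in> B\<rbrakk> \<Longrightarrow> det3 u v w \<in> B"
  by (simp add: det3_def mems)

text \<open>The determinant of three representatives is a nonzero element of the subfield plus a
  multiple of \<open>e\<close> by an element of the subfield, and so it cannot vanish.\<close>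

lemma det3_rep_nonzero:
  assumes "i \<in> I" "j \<in> I" "k \<in> I" "i \<noteq> j" "i \<noteq> k" "j \<noteq> k" and "r \<in> B" "s \<in> B" "t \<in> B"
  shows "det3 (rep i r) (rep j s) (rep k t) \<noteq> 0"
proof
  assume "det3 (rep i r) (rep j s) (rep k t) = 0"
  then have "det3 (c i) (c j) (c k) + e * (r * det3 V (c j) (c k) + s * det3 (c i) V (c k) +
      t * det3 (c i) (c j) V) = 0"
    by (simp only: rep_def det3_translate)
  then have "det3 (c i) (c j) (c k) = 0"
    by (rule zero_if_scaled_mem(1)[OF e_notin, rotated 2])
      (use assms in \<open>simp_all add: mems det3_mem c_mem V_mem\<close>)
  then show False
    using arc assms by blast
qed

lemma inj_on_point_rep: "inj_on (\<lambda>(i, t). point (rep i t)) (I \<times> B)"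
proof (rule inj_onI, clarify)
  fix i t j s assume ij: "i \<in> I" "j \<in> I" "t \<in> B" "s \<in> B" and eq: "point (rep i t) = point (rep j s)"
  have "rep j s \<in> point (rep i t)"
    by (simp add: eq vec.span_base)
  then obtain k where k: "rep j s = k *s rep i t"
    by (auto simp: in_point_iff)
  have "i = j"
  proof (rule ccontr)
    assume "i \<noteq> j"
    have "\<not> I \<subseteq> {i, j}"
      using card_ge_3 card_mono[of "{i, j}" I] \<open>i \<noteq> j\<close> by auto
    then obtain l where "l \<in> I" "l \<noteq> i" "l \<noteq> j"
      by auto
    \<comment> \<open>Completed by a third arc point, the two proportional rows would give a nonzero determinant.\<close>
    then have "det3 (rep l 0) (rep i t) (rep j s) \<noteq> 0"
      using ij \<open>i \<noteq> j\<close> by (intro det3_rep_nonzero) (auto simp: zero_mem)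
    then show False
      by (simp add: k det3_repeat)
  qed
  have "(1 - k) *s c i = (k * t * e - s * e) *s V"
    using k \<open>i = j\<close> by (simp add: rep_def vec_eq_iff algebra_simps)
  then have mult: "(1 - k) *s c i \<in> point V"
    unfolding in_point_iff by blast
  have "k = 1"
  proof (rule ccontr)
    assume "k \<noteq> 1"
    then have "inverse (1 - k) *s ((1 - k) *s c i) = c i"
      by (simp only: vector_smult_assoc) simp
    then have "c i \<in> point V"
      using vec.span_scale[OF mult, of "inverse (1 - k)"] by simp
    then show False
      using c_notin ij by blast
  qed
  then have "((s - t) * e) *s V = 0"
    using k \<open>i = j\<close> by (simp add: rep_def vec_eq_iff algebra_simps)
  moreover have "e \<noteq> 0"
    using e_notin zero_mem by auto
  ultimately have "s = t"
    using V_nonzero by simp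
  then show "i = j \<and> t = s"
    using \<open>i = j\<close> by simp
qed

lemma card_parc: "card parc = card I * card B"
  unfolding parc_def by (subst card_image[OF inj_on_point_rep]) (simp add: card_cartesian_product)

lemma parc_subset: "parc \<subseteq> pg_points"
  by (auto elim!: parcE simp: point_in_pg_points rep_nonzero)

lemma point_rep_in_pencil_line_iff:
  assumes "L \<in> pencil (point V)" "i \<in> I"
  shows "point (rep i t) \<in> L \<longleftrightarrow> line_join V (c i) = L"
proof -
  obtain u where u: "u \<notin> point V" "L = line_join V u"
    using assms(1) V_nonzero by (rule pencilE)
  have "point (rep i t) \<in> L \<longleftrightarrow> c i \<in> vec.span {V, u}"
    using assms(2) by (simp add: u(2) point_in_line_join_iff rep_nonzero rep_in_span_iff)
  also have "\<dots> \<longleftrightarrow> line_join V (c i) = L"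
    using line_join_eq_iff[OF u(1) c_notin[OF assms(2)]] u(2) by auto
  finally show ?thesis .
qed

lemma card_parc_Int_line:
  assumes "L \<in> pencil (point V)"
  shows "card (parc \<inter> L) = card {i \<in> I. line_join V (c i) = L} * card B"
proof -
  have "parc \<inter> L = (\<lambda>(i, t). point (rep i t)) ` ({i \<in> I. line_join V (c i) = L} \<times> B)"
    using point_rep_in_pencil_line_iff[OF assms] by (auto simp: parc_def)
  moreover have "inj_on (\<lambda>(i, t). point (rep i t)) ({i \<in> I. line_join V (c i) = L} \<times> B)"
    by (rule inj_on_subset[OF inj_on_point_rep]) auto
  ultimately show ?thesis
    by (simp add: card_image card_cartesian_product)
qed

lemma join_in_pencil: "i \<in> I \<Longrightarrow> line_join V (c i) \<in> pencil (point V)"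
  using line_join_in_pencil V_nonzero c_notin by blast

lemma independent_if_pair_on_line:
  assumes "P \<in> parc" "Q \<in> parc" "R \<in> parc" "P \<noteq> Q"
    and L: "L \<in> pencil (point V)" "P \<in> L" "Q \<in> L" "R \<notin> L"
  shows "pg_independent {P, Q, R}"
proof -
  obtain u where "L = line_join V u"
    using L(1) V_nonzero by (rule pencilE)
  then show ?thesis
    using assms parc_subset
    by (intro pg_independent_triple[where W = "vec.span {V, u}"]) (auto simp: line_join_def)
qed

lemma independent_if_not_on_pencil_line:
  assumes PQR: "P \<in> parc" "Q \<in> parc" "R \<in> parc" "P \<noteq> Q" "P \<noteq> R" "Q \<noteq> R"
    and no_line: "\<not> (\<exists>L\<in>pencil (point V). {P, Q, R} \<subseteq> L)"
  shows "pg_independent {P, Q, R}"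
proof -
  obtain i r where P: "i \<in> I" "r \<in> B" "P = point (rep i r)"
    using PQR(1) by (rule parcE)
  obtain j s where Q: "j \<in> I" "s \<in> B" "Q = point (rep j s)"
    using PQR(2) by (rule parcE)
  obtain k t where R: "k \<in> I" "t \<in> B" "R = point (rep k t)"
    using PQR(3) by (rule parcE)
  note on = point_rep_in_pencil_line_iff join_in_pencil P Q R
  consider "i = j" | "i = k" | "j = k" | "i \<noteq> j" "i \<noteq> k" "j \<noteq> k"
    by blast
  then show ?thesis
  proof cases
    case 1
    then have "P \<in> line_join V (c i)" "Q \<in> line_join V (c i)"
      using on by auto
    then show ?thesis
      using independent_if_pair_on_line[of P Q R] PQR no_line join_in_pencil P(1) by blast
  next
    case 2
    then have "P \<in> line_join V (c i)" "R \<in> line_join V (c i)"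
      using on by auto
    then have "pg_independent {P, R, Q}"
      using independent_if_pair_on_line[of P R Q] PQR no_line join_in_pencil P(1) by blast
    then show ?thesis
      by (simp add: insert_commute)
  next
    case 3
    then have "Q \<in> line_join V (c j)" "R \<in> line_join V (c j)"
      using on by auto
    then have "pg_independent {Q, R, P}"
      using independent_if_pair_on_line[of Q R P] PQR no_line join_in_pencil Q(1) by blast
    then show ?thesis
      by (simp add: insert_commute)
  next
    case 4
    let ?W = "{w. det3 (rep i r) (rep j s) w = 0}"
    have "det3 (rep i r) (rep j s) (rep k t) \<noteq> 0"
      using 4 P Q R by (intro det3_rep_nonzero) auto
    moreover have "det3 (rep i r) (rep j s) (rep i r) = 0"
      using det3_repeat(1)[of _ _ 1] by simp
    ultimately have "P \<subseteq> ?W" "Q \<subseteq> ?W" "\<not> R \<subseteq> ?W"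
      by (simp_all add: P Q R point_subset_iff[OF subspace_det3_eq_0] det3_repeat)
    then show ?thesis
      using PQR parc_subset by (intro pg_independent_triple[OF _ _ _ _ subspace_det3_eq_0]) auto
  qed
qed

lemma is_parc:
  assumes \<Psi>: "bij_betw \<Psi> {..CARD('a)} (pencil (point V))"
  shows "is_parc (card I * card B) parc \<Psi>"
  unfolding is_parc_def
proof (intro conjI allI impI ballI)
  show "parc \<subseteq> pg_points"
    by (rule parc_subset)
  show "finite parc"
    by simp
  show "card parc = card I * card B"
    by (rule card_parc)
  show "is_pencil \<Psi>"
    using \<Psi> V_nonzero point_in_pg_points by (auto simp: is_pencil_iff)
  show "line_arc (card (parc \<inter> \<Psi> i)) (\<Psi> i) (parc \<inter> \<Psi> i)" for i
    using parc_subset by (auto simp: line_arc_def intro: pg_independent_pair)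
next
  fix i j assume ij: "i \<le> CARD('a)" "j \<le> CARD('a)" "i \<noteq> j"
  have "\<Psi> i \<in> pencil (point V)" "\<Psi> j \<in> pencil (point V)"
    using bij_betwE[OF \<Psi>] ij by auto
  then have "\<Psi> i = \<Psi> j" if "P \<in> parc \<inter> \<Psi> i \<inter> \<Psi> j" for P
    using that point_rep_in_pencil_line_iff by (auto elim!: parcE)
  moreover have "\<Psi> i \<noteq> \<Psi> j"
    using bij_betw_imp_inj_on[OF \<Psi>] ij by (auto dest: inj_onD)
  ultimately show "parc \<inter> \<Psi> i \<inter> \<Psi> j = {}"
    by auto
next
  fix P Q R assume PQR: "P \<in> parc" "Q \<in> parc" "R \<in> parc"
    and h: "P \<noteq> Q \<and> P \<noteq> R \<and> Q \<noteq> R \<and> \<not> (\<exists>i\<le>CARD('a). {P, Q, R} \<subseteq> \<Psi> i)"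
  have "\<not> (\<exists>L\<in>pencil (point V). {P, Q, R} \<subseteq> L)"
    using h bij_betw_imp_surj_on[OF \<Psi>] by (metis (no_types, lifting) atMost_iff imageE)
  then show "pg_independent {P, Q, R}"
    using independent_if_not_on_pencil_line PQR h by blast
qed

end

section \<open>Counting the points on the lines of the pencil\<close>

text \<open>If the fibres of \<open>f\<close> are the orbits of an involution, then one-element fibres correspond to
  fixed points and all other nonempty fibres have two elements.\<close>

lemma involution_fibres:
  fixes f :: "'i \<Rightarrow> 'l"
  assumes fin: "finite I"
    and \<sigma>: "\<forall>i\<in>I. \<sigma> i \<in> I \<and> \<sigma> (\<sigma> i) = i"
    and f: "\<forall>i\<in>I. \<forall>j\<in>I. f i = f j \<longleftrightarrow> j = i \<or> j = \<sigma> i"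
  defines "m \<equiv> \<lambda>L. card {i \<in> I. f i = L}"
  shows "m L \<in> {0, 1, 2}"
    and "card {L. m L = 1} = card {i \<in> I. \<sigma> i = i}"
    and "card {i \<in> I. \<sigma> i = i} + 2 * card {L. m L = 2} = card I"
proof -
  have fibre: "{j \<in> I. f j = f i} = {i, \<sigma> i}" if "i \<in> I" for i
  proof -
    have "f j = f i \<longleftrightarrow> j = i \<or> j = \<sigma> i" if "j \<in> I" for j
      using f \<open>i \<in> I\<close> that by metis
    then show ?thesis
      using \<sigma> that by blast
  qed
  have m: "m (f i) = (if \<sigma> i = i then 1 else 2)" if "i \<in> I" for i
    using fibre[OF that] by (simp add: m_def)
  have m0: "m L = 0 \<longleftrightarrow> L \<notin> f ` I" for L
    using fin by (auto simp: m_def)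
  show "m L \<in> {0, 1, 2}" for L
    using m m0[of L] by (cases "L \<in> f ` I") (auto split: if_splits)
  have one: "{L. m L = 1} = f ` {i \<in> I. \<sigma> i = i}"
  proof (intro equalityI subsetI)
    fix L assume L: "L \<in> {L. m L = 1}"
    then have "L \<in> f ` I"
      using m0[of L] by auto
    then show "L \<in> f ` {i \<in> I. \<sigma> i = i}"
      using L m by (auto split: if_splits)
  qed (use m in auto)
  have "inj_on f {i \<in> I. \<sigma> i = i}"
    by (rule inj_onI) (use f in auto)
  then show card1: "card {L. m L = 1} = card {i \<in> I. \<sigma> i = i}"
    unfolding one by (rule card_image)
  have un: "f ` I = {L. m L = 1} \<union> {L. m L = 2}"
  proof (intro equalityI subsetI)
    fix L assume "L \<in> {L. m L = 1} \<union> {L. m L = 2}"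
    then show "L \<in> f ` I"
      using m0[of L] by auto
  qed (use m in \<open>auto split: if_splits\<close>)
  then have fins: "finite {L. m L = 1}" "finite {L. m L = 2}"
    using fin by (metis finite_Un finite_imageI)+
  have "card I = (\<Sum>L\<in>f ` I. m L)"
    unfolding m_def card_eq_sum using fin by (rule sum.image_gen)
  also have "\<dots> = (\<Sum>L\<in>{L. m L = 1}. m L) + (\<Sum>L\<in>{L. m L = 2}. m L)"
    unfolding un using fins by (intro sum.union_disjoint) auto
  also have "\<dots> = card {L. m L = 1} + 2 * card {L. m L = 2}"
    by simp
  finally show "card {i \<in> I. \<sigma> i = i} + 2 * card {L. m L = 2} = card I"
    using card1 by simp
qed

context translated_arc
begin

text \<open>The hypothesis \<open>join\<close> says that \<open>\<sigma>\<close> interchanges the arc points collinear with \<open>V\<close>. Its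
  fixed points give the tangents through \<open>V\<close>, and its other orbits give the secants.\<close>

lemma card_parc_lines:
  assumes \<sigma>: "\<forall>i\<in>I. \<sigma> i \<in> I \<and> \<sigma> (\<sigma> i) = i"
    and join: "\<forall>i\<in>I. \<forall>j\<in>I. c j \<in> vec.span {V, c i} \<longleftrightarrow> j = i \<or> j = \<sigma> i"
  shows "\<forall>L\<in>pencil (point V). card (parc \<inter> L) \<in> {0, card B, 2 * card B}"
    and "card {L \<in> pencil (point V). card (parc \<inter> L) = card B} = card {i \<in> I. \<sigma> i = i}"
    and "card {i \<in> I. \<sigma> i = i} + 2 * card {L \<in> pencil (point V). card (parc \<inter> L) = 2 * card B}
      = card I"
proof -
  define m where "m L = card {i \<in> I. line_join V (c i) = L}" for L
  have "\<forall>i\<in>I. \<forall>j\<in>I. line_join V (c i) = line_join V (c j) \<longleftrightarrow> j = i \<or> j = \<sigma> i"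
    using join line_join_eq_iff[OF c_notin c_notin] by blast
  note fib = involution_fibres[OF finite_I \<sigma> this, folded m_def]
  have B: "card B > 0"
    using zero_mem by (auto simp: card_gt_0_iff)
  have parc_m: "card (parc \<inter> L) = m L * card B" if "L \<in> pencil (point V)" for L
    using card_parc_Int_line[OF that] by (simp add: m_def)
  have outside: "L \<in> pencil (point V)" if "m L \<noteq> 0" for L
  proof -
    have "{i \<in> I. line_join V (c i) = L} \<noteq> {}"
      using that unfolding m_def by (metis card.empty)
    then show ?thesis
      using join_in_pencil by auto
  qed
  show "\<forall>L\<in>pencil (point V). card (parc \<inter> L) \<in> {0, card B, 2 * card B}"
  proof
    fix L assume "L \<in> pencil (point V)"
    then show "card (parc \<inter> L) \<in> {0, card B, 2 * card B}"
      using fib(1)[of L] parc_m[of L] by auto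
  qed
  have "{L \<in> pencil (point V). card (parc \<inter> L) = card B} = {L. m L = 1}"
    using outside parc_m B by auto
  then show "card {L \<in> pencil (point V). card (parc \<inter> L) = card B} = card {i \<in> I. \<sigma> i = i}"
    using fib(2) by simp
  have "{L \<in> pencil (point V). card (parc \<inter> L) = 2 * card B} = {L. m L = 2}"
    using outside parc_m B by auto
  then show "card {i \<in> I. \<sigma> i = i} + 2 * card {L \<in> pencil (point V). card (parc \<inter> L) = 2 * card B}
      = card I"
    using fib(3) by simp
qed

lemma is_regular_parc_parc:
  assumes "\<forall>L\<in>pencil (point V). card (parc \<inter> L) \<in> {0, h}"
  shows "is_regular_parc (card {L \<in> pencil (point V). card (parc \<inter> L) = h}) h parc"
proof -
  let ?A = "{L \<in> pencil (point V). card (parc \<inter> L) = h}"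
  obtain \<Psi> where \<Psi>: "bij_betw \<Psi> {..CARD('a)} (pencil (point V))"
    and A: "\<forall>i<card ?A. \<Psi> i \<in> ?A" "\<forall>i\<in>{card ?A..CARD('a)}. \<Psi> i \<notin> ?A"
    and le: "card ?A \<le> CARD('a) + 1"
    using exists_pencil_labelling[OF V_nonzero, of ?A] by auto
  have "card (parc \<inter> \<Psi> i) = 0" if "i \<in> {card ?A..CARD('a)}" for i
  proof -
    have "\<Psi> i \<in> pencil (point V)"
      using bij_betwE[OF \<Psi>] that by auto
    then show ?thesis
      using A(2) that assms by blast
  qed
  moreover have "is_parc (card parc) parc \<Psi>"
    using is_parc[OF \<Psi>] by (simp only: card_parc)
  ultimately show ?thesis
    unfolding is_regular_parc_def using le A(1) by blast
qed

lemma exists_is_parc: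
  "\<exists>\<Psi>. is_parc (card I * card B) parc \<Psi> \<and>
    (\<forall>h. card {i. i \<le> CARD('a) \<and> card (parc \<inter> \<Psi> i) = h} =
      card {L \<in> pencil (point V). card (parc \<inter> L) = h})"
proof -
  obtain \<Psi> where \<Psi>: "bij_betw \<Psi> {..CARD('a)} (pencil (point V))"
    using exists_pencil_labelling[OF V_nonzero, of "{}"] by auto
  have "bij_betw \<Psi> {i. i \<le> CARD('a) \<and> card (parc \<inter> \<Psi> i) = h}
      {L \<in> pencil (point V). card (parc \<inter> L) = h}" for h
    by (rule bij_betw_subset[OF \<Psi>]) (auto simp flip: bij_betw_imp_surj_on[OF \<Psi>])
  then show ?thesis
    using is_parc[OF \<Psi>] bij_betw_same_card by blast
qed

end

section \<open>The conic and its points collinear with a given point\<close>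

text \<open>The points of the conic with equation \<open>y\<^sup>2 = x z\<close>, parametrised by the
  projective line; \<open>None\<close> is the parameter at infinity.\<close>

definition conic_point :: "'a::field option \<Rightarrow> 'a ^ 3" where
  "conic_point = case_option (vector [1, 0, 0]) (\<lambda>s. vector [s\<^sup>2, s, 1])"

lemma conic_point_simps [simp]:
  "conic_point None $ 1 = 1" "conic_point None $ 2 = 0" "conic_point None $ 3 = 0"
  "conic_point (Some s) $ 1 = s\<^sup>2" "conic_point (Some s) $ 2 = s" "conic_point (Some s) $ 3 = 1"
  by (simp_all add: conic_point_def)

text \<open>For three finite parameters, the determinant is a Vandermonde determinant.\<close>

lemma det3_conic_point_nonzero:
  assumes "i \<noteq> j" "i \<noteq> k" "j \<noteq> k"
  shows "det3 (conic_point i) (conic_point j) (conic_point k) \<noteq> 0"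
proof -
  have "det3 (conic_point (Some r)) (conic_point (Some s)) (conic_point (Some t))
      = (r - s) * (r - t) * (s - t)" for r s t :: 'a
    by (simp add: det3_def algebra_simps power2_eq_square)
  then show ?thesis
    using assms by (cases i; cases j; cases k) (auto simp: det3_def)
qed

text \<open>The parameters of the conic points that are rational over \<open>B\<close>.\<close>

abbreviation proj_line :: "'a set \<Rightarrow> 'a option set" where
  "proj_line B \<equiv> insert None (Some ` B)"

lemma card_proj_line: "finite B \<Longrightarrow> card (proj_line B) = card B + 1"
  by (subst card_insert_disjoint) (auto simp: card_image)

lemma (in closed_subfield) conic_point_mem: "i \<in> proj_line B \<Longrightarrow> conic_point i $ j \<in> B"
  using exhaust_3[of j] by (auto simp: mems power2_eq_square)

lemma in_span2_vec3_iff: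
  fixes x V u :: "'a::field ^ 3"
  shows "x \<in> vec.span {V, u} \<longleftrightarrow>
    (\<exists>a b. x$1 = a * V$1 + b * u$1 \<and> x$2 = a * V$2 + b * u$2 \<and> x$3 = a * V$3 + b * u$3)"
  by (simp add: in_span2_iff vec_eq_iff forall_3)

lemma in_point_vec3_iff:
  fixes x V :: "'a::field ^ 3"
  shows "x \<in> point V \<longleftrightarrow> (\<exists>a. x$1 = a * V$1 \<and> x$2 = a * V$2 \<and> x$3 = a * V$3)"
  by (simp add: in_point_iff vec_eq_iff forall_3)

text \<open>The point \<open>(1, 0, 0)\<close> is the point of the conic with parameter \<open>None\<close>, and a line through it
  meets the conic in at most one further point.\<close>

lemma conic_join_conic_point:
  "conic_point (Some t) \<in> vec.span {vector [1, 0, 0], conic_point (Some s)} \<longleftrightarrow> t = s"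
  by (auto simp: in_span2_vec3_iff intro: exI[of _ 0])

text \<open>The involution that the point \<open>(0, 1, 0)\<close> induces on the parameters of the conic.\<close>

fun ext_involution :: "'a::field option \<Rightarrow> 'a option" where
  "ext_involution None = None"
| "ext_involution (Some s) = Some (- s)"

lemma conic_join_external_point:
  "conic_point j \<in> vec.span {vector [0, 1, 0], conic_point i} \<longleftrightarrow> j = i \<or> j = ext_involution i"
proof (cases i; cases j)
  fix s t assume ij: "i = Some s" "j = Some t"
  have "conic_point j \<in> vec.span {vector [0, 1, 0], conic_point i} \<longleftrightarrow> t\<^sup>2 = s\<^sup>2"
    by (auto simp: ij in_span2_vec3_iff intro: exI[of _ "t - s"])
  then show ?thesis
    by (auto simp: ij power2_eq_iff)
qed (auto simp: in_span2_vec3_iff)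

text \<open>The involution \<open>s \<mapsto> n / s\<close> that the point \<open>(n, 0, - 1)\<close> induces on the
  parameters of the conic, where \<open>n \<noteq> 0\<close>; it interchanges \<open>0\<close> and infinity.\<close>

fun int_involution :: "'a::field \<Rightarrow> 'a option \<Rightarrow> 'a option" where
  "int_involution n None = Some 0"
| "int_involution n (Some s) = (if s = 0 then None else Some (n / s))"

lemma conic_join_internal_point:
  assumes "n \<noteq> 0"
  shows "conic_point j \<in> vec.span {vector [n, 0, - 1], conic_point i} \<longleftrightarrow> j = i \<or> j = int_involution n i"
proof (cases i; cases j)
  fix s t assume ij: "i = Some s" "j = Some t"
  show ?thesis
  proof
    assume "conic_point j \<in> vec.span {vector [n, 0, - 1], conic_point i}"
    then obtain a b where ab: "t\<^sup>2 = a * n + b * s\<^sup>2" "t = b * s" "1 = b - a"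
      by (auto simp: ij in_span2_vec3_iff)
    then have a: "a = b - 1"
      by (simp add: algebra_simps)
    have "(b - 1) * (n - b * s\<^sup>2) = 0"
      using ab(1) unfolding ab(2) a by (simp add: algebra_simps power2_eq_square)
    then have "b = 1 \<or> n = b * s\<^sup>2"
      by (simp only: mult_eq_0_iff right_minus_eq)
    then show "j = i \<or> j = int_involution n i"
    proof
      assume "n = b * s\<^sup>2"
      then have "n = t * s"
        using ab(2) by (simp add: power2_eq_square)
      then show ?thesis
        using assms by (auto simp: ij)
    qed (simp add: ij ab(2))
  next
    assume "j = i \<or> j = int_involution n i"
    then show "conic_point j \<in> vec.span {vector [n, 0, - 1], conic_point i}"
    proof
      assume "j = i"
      then show ?thesis
        by (simp add: vec.span_base)
    next
      assume "j = int_involution n i"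
      then have s: "s \<noteq> 0" "t = n / s"
        by (auto simp: ij split: if_splits)
      show ?thesis
        unfolding in_span2_vec3_iff
        by (rule exI[of _ "n / s\<^sup>2 - 1"], rule exI[of _ "n / s\<^sup>2"])
          (use s in \<open>simp add: ij field_simps power2_eq_square\<close>)
    qed
  qed
next
  fix t assume ij: "i = None" "j = Some t"
  have "conic_point (Some 0) \<in> vec.span {vector [n, 0, - 1], conic_point None}"
    unfolding in_span2_vec3_iff by (rule exI[of _ "- 1"], rule exI[of _ n]) simp
  moreover have "t = 0" if "conic_point j \<in> vec.span {vector [n, 0, - 1], conic_point i}"
    using that by (auto simp: ij in_span2_vec3_iff)
  ultimately show ?thesis
    by (auto simp: ij)
next
  fix s assume ij: "i = Some s" "j = None"
  show ?thesis
    using assms by (auto simp: ij in_span2_vec3_iff intro!: exI[of _ "1 / n"])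
qed (auto simp: in_span2_vec3_iff intro: exI[of _ 0] exI[of _ 1])

lemma translated_arc_conic:
  fixes V :: "'a::{field,finite} ^ 3"
  assumes "closed_subfield B" "e \<notin> B" "V$1 \<in> B" "V$2 \<in> B" "V$3 \<in> B" "V \<noteq> 0"
    and I: "I \<subseteq> proj_line B" "card I \<ge> 3" "\<And>i. i \<in> I \<Longrightarrow> conic_point i \<notin> point V"
  shows "translated_arc B e V conic_point I"
proof -
  interpret closed_subfield B
    by fact
  show ?thesis
  proof unfold_locales
    show "V $ j \<in> B" for j
      using assms exhaust_3[of j] by auto
    show "conic_point i $ j \<in> B" if "i \<in> I" for i j
      using conic_point_mem I(1) that by blast
    show "det3 (conic_point i) (conic_point j) (conic_point k) \<noteq> 0"
      if "i \<noteq> j" "i \<noteq> k" "j \<noteq> k" for i j k :: "'a option"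
      using that by (rule det3_conic_point_nonzero)
  qed (use assms in auto)
qed

section \<open>The three pencil arcs\<close>

text \<open>The vertices are \<open>(0, 1, 0)\<close>, an external point, \<open>(n, 0, - 1)\<close>, an internal point when
  \<open>n\<close> is a nonsquare, and \<open>(1, 0, 0)\<close>, a point of the conic. Odd characteristic enters twice:
  \<open>s \<mapsto> - s\<close> fixes only \<open>0\<close> and infinity, and the subfield contains a nonsquare
  \<open>n\<close>, so that \<open>s \<mapsto> n / s\<close> has no fixed points.\<close>

lemma exists_parcs:
  fixes B :: "'a::{field,finite} set"
  assumes "closed_subfield B" and card: "card B \<ge> 3" and e: "e \<notin> B" and char: "(1 :: 'a) \<noteq> - 1"
  defines "q \<equiv> card B"
  shows external_parc: "\<exists>(K :: 'a pg_point set) \<Psi>. is_parc (q ^ 2 + q) K \<Psi> \<and>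
            card {i. i \<le> CARD('a) \<and> card (K \<inter> \<Psi> i) = q} = 2 \<and>
            card {i. i \<le> CARD('a) \<and> card (K \<inter> \<Psi> i) = 2 * q} = (q - 1) div 2"
    and internal_parc: "\<exists>K :: 'a pg_point set. is_regular_parc ((q + 1) div 2) (2 * q) K"
    and conic_parc: "\<exists>K :: 'a pg_point set. is_regular_parc q q K"
proof -
  interpret closed_subfield B
    by fact
  have card_P: "card (proj_line B) = q + 1"
    unfolding q_def by (rule card_proj_line) simp
  show "\<exists>K :: 'a pg_point set. is_regular_parc q q K"
  proof -
    let ?V = "vector [1, 0, 0] :: 'a ^ 3"
    let ?I = "Some ` B"
    have I: "card ?I = q"
      by (simp add: card_image q_def)
    have "translated_arc B e ?V conic_point ?I"
      using e I card by (intro translated_arc_conic assms(1))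
        (auto simp: mems q_def in_point_vec3_iff vec_eq_iff exI[of _ 1])
    then interpret translated_arc B e ?V conic_point ?I .
    have "\<forall>i\<in>?I. id i \<in> ?I \<and> id (id i) = i"
      "\<forall>i\<in>?I. \<forall>j\<in>?I. conic_point j \<in> vec.span {?V, conic_point i} \<longleftrightarrow> j = i \<or> j = id i"
      using conic_join_conic_point by auto
    note lines = card_parc_lines[OF this(1) this(2)]
    have fixed: "{i \<in> ?I. id i = i} = ?I"
      by auto
    have two: "{L \<in> pencil (point ?V). card (parc \<inter> L) = 2 * q} = {}"
      using lines(3) I by (simp add: fixed q_def)
    have "\<forall>L\<in>pencil (point ?V). card (parc \<inter> L) \<in> {0, q}"
      using lines(1) two by (auto simp: q_def)
    from is_regular_parc_parc[OF this] show ?thesis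
      using lines(2) by (auto simp: I fixed simp flip: q_def)
  qed
  show "\<exists>(K :: 'a pg_point set) \<Psi>. is_parc (q ^ 2 + q) K \<Psi> \<and>
            card {i. i \<le> CARD('a) \<and> card (K \<inter> \<Psi> i) = q} = 2 \<and>
            card {i. i \<le> CARD('a) \<and> card (K \<inter> \<Psi> i) = 2 * q} = (q - 1) div 2"
  proof -
    let ?V = "vector [0, 1, 0] :: 'a ^ 3"
    have "conic_point i \<notin> point ?V" for i
      by (cases i) (auto simp: in_point_vec3_iff)
    then have "translated_arc B e ?V conic_point (proj_line B)"
      using e card_P card by (intro translated_arc_conic assms(1))
        (auto simp: mems q_def vec_eq_iff exI[of _ 2])
    then interpret translated_arc B e ?V conic_point "proj_line B" .
    have inv: "\<forall>i\<in>proj_line B. ext_involution i \<in> proj_line B \<and> ext_involution (ext_involution i) = i"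
      by (auto simp: uminus_mem)
    have "\<forall>i\<in>proj_line B. \<forall>j\<in>proj_line B.
        conic_point j \<in> vec.span {?V, conic_point i} \<longleftrightarrow> j = i \<or> j = ext_involution i"
      using conic_join_external_point by blast
    note lines = card_parc_lines[OF inv this]
    have neg: "- s = s \<longleftrightarrow> s = 0" for s :: 'a
      using char mult_right_cancel[of s "- 1" 1] by auto
    have "ext_involution i = i \<longleftrightarrow> i = None \<or> i = Some 0" for i :: "'a option"
      by (cases i) (simp_all add: neg)
    then have "{i \<in> proj_line B. ext_involution i = i} = {None, Some 0}"
      using zero_mem by auto
    then have fixed: "card {i \<in> proj_line B. ext_involution i = i} = 2"
      by simp
    then have n1: "card {L \<in> pencil (point ?V). card (parc \<inter> L) = q} = 2"
      using lines(2) by (simp only: q_def)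
    have "2 + 2 * card {L \<in> pencil (point ?V). card (parc \<inter> L) = 2 * q} = q + 1"
      using lines(3) fixed card_P by (simp only: q_def)
    then have n2: "card {L \<in> pencil (point ?V). card (parc \<inter> L) = 2 * q} = (q - 1) div 2"
      by simp
    have "card (proj_line B) * card B = q ^ 2 + q"
      using card_P by (simp add: q_def power2_eq_square algebra_simps)
    then obtain \<Psi> where "is_parc (q ^ 2 + q) parc \<Psi>"
      "\<forall>h. card {i. i \<le> CARD('a) \<and> card (parc \<inter> \<Psi> i) = h} =
        card {L \<in> pencil (point ?V). card (parc \<inter> L) = h}"
      using exists_is_parc by auto
    then show ?thesis
      using n1 n2 by (intro exI[of _ parc] exI[of _ \<Psi>]) (simp only: simp_thms)
  qed
  show "\<exists>K :: 'a pg_point set. is_regular_parc ((q + 1) div 2) (2 * q) K"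
  proof -
    obtain n where n: "n \<in> B" "\<forall>s\<in>B. s * s \<noteq> n"
      using exists_nonsquare char by auto
    then have "n \<noteq> 0"
      using zero_mem by force
    let ?V = "vector [n, 0, - 1] :: 'a ^ 3"
    have "conic_point i \<notin> point ?V" for i
      using \<open>n \<noteq> 0\<close> by (cases i) (auto simp: in_point_vec3_iff)
    then have "translated_arc B e ?V conic_point (proj_line B)"
      using e card_P card n(1) \<open>n \<noteq> 0\<close>
      by (intro translated_arc_conic assms(1)) (auto simp: mems q_def vec_eq_iff exI[of _ 1])
    then interpret translated_arc B e ?V conic_point "proj_line B" .
    have inv: "\<forall>i\<in>proj_line B. int_involution n i \<in> proj_line B \<and> int_involution n (int_involution n i) = i"
      using n \<open>n \<noteq> 0\<close> by (auto simp: mems)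
    have "\<forall>i\<in>proj_line B. \<forall>j\<in>proj_line B.
        conic_point j \<in> vec.span {?V, conic_point i} \<longleftrightarrow> j = i \<or> j = int_involution n i"
      using conic_join_internal_point \<open>n \<noteq> 0\<close> by blast
    note lines = card_parc_lines[OF inv this]
    have "int_involution n i \<noteq> i" if "i \<in> proj_line B" for i
      using that n by (auto simp: field_simps split: if_splits)
    then have fixed: "{i \<in> proj_line B. int_involution n i = i} = {}"
      by blast
    have one: "{L \<in> pencil (point ?V). card (parc \<inter> L) = q} = {}"
    proof -
      have "card {L \<in> pencil (point ?V). card (parc \<inter> L) = q} = 0"
        using lines(2) by (simp only: fixed q_def card.empty)
      then show ?thesis
        by (subst (asm) card_0_eq) auto
    qed
    have "\<forall>L\<in>pencil (point ?V). card (parc \<inter> L) \<in> {0, 2 * q}"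
      using lines(1) one unfolding q_def by blast
    note reg = is_regular_parc_parc[OF this]
    have "2 * card {L \<in> pencil (point ?V). card (parc \<inter> L) = 2 * q} = q + 1"
      using lines(3) by (simp only: fixed card_P q_def card.empty add_0)
    then have "card {L \<in> pencil (point ?V). card (parc \<inter> L) = 2 * q} = (q + 1) div 2"
      by simp
    then show ?thesis
      using reg by metis
  qed
qed

theorem theorem5p2:
  fixes q :: nat
  assumes "primepow q" and "odd q"
    and "CARD('a::{field,finite}) = q ^ 2"
  shows "(\<exists>(K :: 'a pg_point set) \<Psi>. is_parc (q ^ 2 + q) K \<Psi> \<and>
            card {i. i \<le> CARD('a) \<and> card (K \<inter> \<Psi> i) = q} = 2 \<and>
            card {i. i \<le> CARD('a) \<and> card (K \<inter> \<Psi> i) = 2 * q} = (q - 1) div 2) \<and>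
         (\<exists>K :: 'a pg_point set. is_regular_parc ((q + 1) div 2) (2 * q) K) \<and>
         (\<exists>K :: 'a pg_point set. is_regular_parc q q K)"
proof -
  obtain B :: "'a set" where B: "closed_subfield B" "card B = q"
    using exists_closed_subfield[OF assms(1,3)] by blast
  have "q > 1"
    using assms(1) primepow_gt_Suc_0 by fastforce
  with assms(2) have q: "q \<ge> 3"
    by (cases "q = 2") auto
  have "B \<noteq> UNIV"
    using B(2) assms(3) \<open>q > 1\<close> by (auto simp: power2_eq_square)
  then obtain e where e: "e \<notin> B"
    by auto
  have "(1 :: 'a) \<noteq> - 1"
    using assms(2,3) by (intro one_neq_minus_one) simp
  note parcs = exists_parcs[OF B(1) _ e this, unfolded B(2), OF q]
  show ?thesis
    by (intro conjI parcs)
qed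

end
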